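(* Let $C^1,C^2$ be independent Cauchy processes and let $$q(x,t)=\frac{2}{\pi^2}\int_0^\infty\frac{s}{s^2+x^2}\,\frac{t}{t^2+s^2}\,ds,\qquad x\in\mathbb{R}\setminus\{0\},\ t>0,$$ be the density of the iterated Cauchy process $I_C(t)=C^1(|C^2(t)|)$, $t>0$. Then $q$ has the explicit form $$q(x,t)=\frac{2t}{\pi^2(t^2-x^2)}\log\frac{t}{|x|},\qquad x\in\mathbb{R}\setminus\{0\},\ t>0$$ (extended by continuity at $|x|=t$), and satisfies the non-homogeneous wave equation $$\frac{\partial^2q}{\partial t^2}=\frac{\partial^2q}{\partial x^2}-\frac{2}{\pi^2tx^2},\qquad x\in\mathbb{R}\setminus\{0\},\ t>0 .$$
   Context: The Cauchy process $C(t)$, $t>0$, is the process whose law at time $t$ has density $\frac{t}{\pi(t^2+x^2)}$, $x\in\mathbb{R}$ (standard symmetric Cauchy Lévy process). *)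

theory Defs
  imports "HOL-Probability.Probability"
begin

definition cadlag :: "(real \<Rightarrow> real) \<Rightarrow> bool" where
  "cadlag f \<longleftrightarrow>
     (\<forall>t\<ge>0. continuous (at_right t) f) \<and>
     (\<forall>t>0. \<exists>l. (f \<longlongrightarrow> l) (at_left t))"

text \<open>
  Processes are indexed by all reals, but only their values at times \<open>t \<ge> 0\<close> are constrained.
\<close>

definition levy_process :: "'a measure \<Rightarrow> (real \<Rightarrow> 'a \<Rightarrow> real) \<Rightarrow> bool" where
  "levy_process M X \<longleftrightarrow>
     prob_space M \<and>
     (\<forall>t\<ge>0. X t \<in> borel_measurable M) \<and>
     (AE \<omega> in M. X 0 \<omega> = 0) \<and>
     (\<forall>(n::nat) (\<tau>::nat \<Rightarrow> real). 0 \<le> \<tau> 0 \<longrightarrow> strict_mono_on {..n} \<tau> \<longrightarrow>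
        prob_space.indep_vars M (\<lambda>_. borel) (\<lambda>i \<omega>. X (\<tau> (Suc i)) \<omega> - X (\<tau> i) \<omega>) {..<n}) \<and>
     (\<forall>s\<ge>0. \<forall>h\<ge>0. distr M borel (\<lambda>\<omega>. X (s + h) \<omega> - X s \<omega>) = distr M borel (X h)) \<and>
     (\<forall>s\<ge>0. \<forall>\<epsilon>>0.
        ((\<lambda>t. measure M {\<omega> \<in> space M. \<bar>X t \<omega> - X s \<omega>\<bar> > \<epsilon>}) \<longlongrightarrow> 0) (at s within {0..})) \<and>
     (AE \<omega> in M. cadlag (\<lambda>t. X t \<omega>))"

definition cauchy_process :: "'a measure \<Rightarrow> (real \<Rightarrow> 'a \<Rightarrow> real) \<Rightarrow> bool" where
  "cauchy_process M C \<longleftrightarrow>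
     levy_process M C \<and>
     (\<forall>t>0. distributed M lborel (C t) (\<lambda>x. ennreal (t / (pi * (t\<^sup>2 + x\<^sup>2)))))"

text \<open>
  Independence of the two whole processes: the sigma-algebra generated by the path map into the
  product space is the one generated by all the random variables \<open>X t\<close>, \<open>t \<ge> 0\<close>.
\<close>

definition indep_processes ::
    "'a measure \<Rightarrow> (real \<Rightarrow> 'a \<Rightarrow> real) \<Rightarrow> (real \<Rightarrow> 'a \<Rightarrow> real) \<Rightarrow> bool" where
  "indep_processes M X Y \<longleftrightarrow>
     prob_space.indep_var M
       (PiM {0..} (\<lambda>_. borel)) (\<lambda>\<omega>. \<lambda>t\<in>{0..}. X t \<omega>)
       (PiM {0..} (\<lambda>_. borel)) (\<lambda>\<omega>. \<lambda>t\<in>{0..}. Y t \<omega>)"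

text \<open>
  Since paths are cadlag only almost surely, this is in general measurable only with respect to
  the completion of the underlying probability space.
\<close>

definition iterated_process ::
    "(real \<Rightarrow> 'a \<Rightarrow> real) \<Rightarrow> (real \<Rightarrow> 'a \<Rightarrow> real) \<Rightarrow> real \<Rightarrow> 'a \<Rightarrow> real" where
  "iterated_process X Y t \<omega> = X \<bar>Y t \<omega>\<bar> \<omega>"

text \<open>
  The integral diverges at \<open>x = 0\<close>, where the Lebesgue integral takes the default value \<open>0\<close>;
  only \<open>x \<noteq> 0\<close> is meaningful.
\<close>

definition q :: "real \<Rightarrow> real \<Rightarrow> real" where
  "q x t = 2 / pi\<^sup>2 * (LBINT s:{0<..}. s / (s\<^sup>2 + x\<^sup>2) * (t / (t\<^sup>2 + s\<^sup>2)))"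

end

theory Submission
  imports Defs "HOL-Complex_Analysis.Complex_Analysis"
begin

text \<open>
  The function \<open>ln w / (w - 1)\<close> extends holomorphically through \<open>w = 1\<close>, and in terms of this
  extension \<open>\<phi>\<close> the integral is \<open>q x t = t / (pi\<^sup>2 x\<^sup>2) \<phi> (t\<^sup>2 / x\<^sup>2)\<close>, with no singularity on
  \<open>\<bar>x\<bar> = t\<close>. The wave equation is then the second-order equation for \<open>\<phi>\<close> that results from
  differentiating \<open>(w - 1) \<phi> w = ln w\<close>.

  For the law of \<open>C1 \<bar>C2 t\<bar>\<close>, round the random time \<open>\<bar>C2 t\<bar>\<close> up to a lattice. By independence the
  expectation of a bounded continuous function of the rounded process is an iterated integral, and
  right continuity of the paths lets the mesh tend to zero. Tonelli's theorem turns the limit into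
  an integral against \<open>q\<close>.
\<close>

section \<open>The removable singularity of the logarithmic quotient\<close>

text \<open>This is the function called \<open>\<phi>\<close> above. The value 1 is the limit of the
  quotient at 1, that is, the derivative of the logarithm there.\<close>

definition log_quot :: "real \<Rightarrow> real" where
  "log_quot w = (if w = 1 then 1 else ln w / (w - 1))"

lemma log_quot_mult: "(w - 1) * log_quot w = ln w"
  by (simp add: log_quot_def)

text \<open>Restriction to the real axis and the real part are both real-linear, so they pass
  through the complex derivative. This serves first for an extension of \<open>log_quot\<close> and
  then for the derivative of that extension.\<close>

lemma real_derivative_of_holomorphic_extension:
  assumes F: "F holomorphic_on S" "open S" and w: "complex_of_real w \<in> S"
  shows "((\<lambda>u. Re (F (of_real u))) has_real_derivative Re (deriv F (of_real w))) (at w)"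
proof -
  have "(F has_field_derivative deriv F (of_real w)) (at (of_real w))"
    using F w by (rule holomorphic_derivI)
  then have "((\<lambda>u. F (of_real u)) has_vector_derivative deriv F (of_real w)) (at w)"
    by (rule has_vector_derivative_real_field)
  then have "((\<lambda>u. Re (F (of_real u))) has_vector_derivative Re (deriv F (of_real w))) (at w)"
    by (rule bounded_linear.has_vector_derivative[OF bounded_linear_Re])
  then show ?thesis
    by (simp add: has_real_derivative_iff_has_vector_derivative)
qed

text \<open>Differentiating the quotient directly would need expansions at 1. The removable
  singularity theorem on the slit plane instead gives a holomorphic extension, whose derivative is
  holomorphic again, so smoothness at 1 comes for free.\<close>

lemma log_quot_twice_differentiable:
  obtains f' f'' where
    "\<And>w. w > 0 \<Longrightarrow> (log_quot has_real_derivative f' w) (at w)"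
    "\<And>w. w > 0 \<Longrightarrow> (f' has_real_derivative f'' w) (at w)"
proof -
  define S where "S = - (\<real>\<^sub>\<le>\<^sub>0 :: complex set)"
  \<comment> \<open>The term \<open>Ln 1\<close>, although zero, is kept so that \<open>F\<close> is
    literally the difference quotient of \<open>Ln\<close> at 1, the shape to which
    \<open>pole_lemma_open\<close> applies.\<close>
  define F where "F = (\<lambda>z::complex. if z = 1 then deriv Ln 1 else (Ln z - Ln 1) / (z - 1))"
  have S: "open S"
    by (simp add: S_def open_Compl)
  have "Ln holomorphic_on S"
    unfolding S_def by (intro holomorphic_intros) auto
  then have F: "F holomorphic_on S"
    unfolding F_def using S by (rule pole_lemma_open)
  then have F': "deriv F holomorphic_on S"
    using S by (rule holomorphic_deriv)
  have pos_in_S: "complex_of_real w \<in> S" if "w > 0" for w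
    using that by (auto simp: S_def complex_nonpos_Reals_iff)
  have "deriv Ln 1 = (1 :: complex)"
    by (rule DERIV_imp_deriv) (auto intro!: derivative_eq_intros)
  then have log_quot: "Re (F (of_real w)) = log_quot w" if "w > 0" for w
  proof -
    have "F (of_real w) = of_real (log_quot w)"
      using that \<open>deriv Ln 1 = 1\<close> by (simp add: F_def log_quot_def Ln_of_real)
    then show ?thesis by simp
  qed
  have D: "(log_quot has_real_derivative Re (deriv F (of_real w))) (at w)" if "w > 0" for w
  proof (rule has_field_derivative_transform_within_open)
    show "((\<lambda>u. Re (F (of_real u))) has_real_derivative Re (deriv F (of_real w))) (at w)"
      using F S pos_in_S[OF that] by (rule real_derivative_of_holomorphic_extension)
    show "\<And>y. y \<in> {0<..} \<Longrightarrow> Re (F (of_real y)) = log_quot y"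
      by (simp add: log_quot)
  qed (use that in auto)
  show ?thesis
    by (rule that[OF D real_derivative_of_holomorphic_extension[OF F' S pos_in_S]])
qed

lemma isCont_log_quot: "w > 0 \<Longrightarrow> isCont log_quot w"
  by (meson log_quot_twice_differentiable DERIV_isCont)

text \<open>Obtained by differentiating \<open>(w - 1) * log_quot w = ln w\<close> twice, so they also hold at \<open>w = 1\<close>.\<close>
lemma log_quot_derivative_identities:
  assumes D1: "\<And>w. w > 0 \<Longrightarrow> (log_quot has_real_derivative f' w) (at w)"
    and D2: "\<And>w. w > 0 \<Longrightarrow> (f' has_real_derivative f'' w) (at w)"
    and w: "w > 0"
  shows "(w - 1) * f' w + log_quot w = 1 / w"
    and "(w - 1) * f'' w + 2 * f' w = - 1 / w\<^sup>2"
proof -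
  have *: "(v - 1) * f' v + log_quot v = 1 / v" if "v > 0" for v
  proof (rule DERIV_unique)
    show "((\<lambda>v. (v - 1) * log_quot v) has_real_derivative (v - 1) * f' v + log_quot v) (at v)"
      using that by (auto intro!: derivative_eq_intros D1)
    show "((\<lambda>v. (v - 1) * log_quot v) has_real_derivative 1 / v) (at v)"
      unfolding log_quot_mult using that by (auto intro!: derivative_eq_intros)
  qed
  then show "(w - 1) * f' w + log_quot w = 1 / w"
    using w by blast
  show "(w - 1) * f'' w + 2 * f' w = - 1 / w\<^sup>2"
  proof (rule DERIV_unique)
    show "((\<lambda>v. (v - 1) * f' v + log_quot v) has_real_derivative (w - 1) * f'' w + 2 * f' w) (at w)"
      using w by (auto intro!: derivative_eq_intros D1 D2)
    show "((\<lambda>v. (v - 1) * f' v + log_quot v) has_real_derivative - 1 / w\<^sup>2) (at w)"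
    proof (rule has_field_derivative_transform_within_open)
      show "((\<lambda>v. 1 / v) has_real_derivative - 1 / w\<^sup>2) (at w)"
        using w by (auto intro!: derivative_eq_intros simp: power2_eq_square)
      show "\<And>y. y \<in> {0<..} \<Longrightarrow> 1 / y = (y - 1) * f' y + log_quot y"
        by (simp add: *)
    qed (use w in auto)
  qed
qed

section \<open>The explicit form of the density and the wave equation\<close>

text \<open>An explicit primitive tends to 0 at infinity, so the integral is minus its value at 0.
  The primitive is rational for \<open>t^2 = x^2\<close> and logarithmic otherwise;
  \<open>log_quot\<close> merges the two values. Since the integrand is nonnegative, finiteness of
  the integral comes with its value.\<close>

lemma nn_integral_cauchy_product_Ici:
  fixes x t :: real
  assumes x: "x \<noteq> 0" and t: "t > 0"
  shows "(\<integral>\<^sup>+ s. ennreal (s / (s\<^sup>2 + x\<^sup>2) * (t / (t\<^sup>2 + s\<^sup>2))) * indicator {0..} s \<partial>lborel)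
       = ennreal (t / (2 * x\<^sup>2) * log_quot (t\<^sup>2 / x\<^sup>2))"
proof -
  let ?f = "\<lambda>s. s / (s\<^sup>2 + x\<^sup>2) * (t / (t\<^sup>2 + s\<^sup>2))"
  have nz: "s\<^sup>2 + x\<^sup>2 > 0" "t\<^sup>2 + s\<^sup>2 > 0" "s\<^sup>2 + t\<^sup>2 > 0" for s
    using x t by (auto intro: add_nonneg_pos add_pos_nonneg)
  have nonneg: "0 \<le> ?f s" if "0 \<le> s" for s
    using that t nz[of s] by (intro mult_nonneg_nonneg divide_nonneg_nonneg) auto
  show ?thesis
  proof (cases "t\<^sup>2 = x\<^sup>2")
    case True
    \<comment> \<open>Here the integrand is \<open>t * s / (s^2 + t^2)^2\<close>.\<close>
    have "(\<integral>\<^sup>+ s. ennreal (?f s) * indicator {0..} s \<partial>lborel) = ennreal (0 - - (t / 2) * inverse (0\<^sup>2 + t\<^sup>2))"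
    proof (rule nn_integral_FTC_atLeast)
      show "((\<lambda>s. - (t / 2) * inverse (s\<^sup>2 + t\<^sup>2)) has_real_derivative ?f s) (at s)" for s
      proof -
        have "((\<lambda>s. s\<^sup>2 + t\<^sup>2) has_real_derivative 2 * s) (at s)"
          by (auto intro!: derivative_eq_intros)
        then have "((\<lambda>s. - (t / 2) * inverse (s\<^sup>2 + t\<^sup>2)) has_real_derivative
            - (t / 2) * - (inverse (s\<^sup>2 + t\<^sup>2) * (2 * s) * inverse (s\<^sup>2 + t\<^sup>2))) (at s)"
          by (intro DERIV_cmult DERIV_inverse') (use nz[of s] in auto)
        moreover have "- (t / 2) * - (inverse d * (2 * s) * inverse d) = s / d * (t / d)" for d
          by (simp add: divide_simps)
        ultimately show ?thesis
          by (simp only: True[symmetric] add.commute[of "t\<^sup>2" "s\<^sup>2"])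
      qed
      show "((\<lambda>s. - (t / 2) * inverse (s\<^sup>2 + t\<^sup>2)) \<longlongrightarrow> 0) at_top"
        by real_asymp
    qed (use nonneg in auto)
    also have "0 - - (t / 2) * inverse (0\<^sup>2 + t\<^sup>2) = t / (2 * x\<^sup>2) * log_quot (t\<^sup>2 / x\<^sup>2)"
      unfolding True using x by (simp add: log_quot_def inverse_eq_divide)
    finally show ?thesis .
  next
    case False
    have ln_deriv: "((\<lambda>s. ln (s\<^sup>2 + a\<^sup>2)) has_real_derivative 2 * s / (s\<^sup>2 + a\<^sup>2)) (at s)"
      if "0 < s\<^sup>2 + a\<^sup>2" for a s :: real
    proof -
      have "((\<lambda>s. s\<^sup>2 + a\<^sup>2) has_real_derivative 2 * s) (at s)"
        by (auto intro!: derivative_eq_intros)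
      from DERIV_chain2[OF DERIV_ln_divide[OF that] this] show ?thesis
        by simp
    qed
    \<comment> \<open>Partial fractions: \<open>1/(s^2+x^2) - 1/(s^2+t^2)\<close> is
      \<open>(t^2-x^2) / ((s^2+x^2) * (s^2+t^2))\<close>. The 2 in the denominator cancels the one
      from differentiating \<open>s^2\<close>.\<close>
    let ?c = "t / (2 * (t\<^sup>2 - x\<^sup>2))"
    have "(\<integral>\<^sup>+ s. ennreal (?f s) * indicator {0..} s \<partial>lborel)
        = ennreal (0 - ?c * (ln (0\<^sup>2 + x\<^sup>2) - ln (0\<^sup>2 + t\<^sup>2)))"
    proof (rule nn_integral_FTC_atLeast)
      show "((\<lambda>s. ?c * (ln (s\<^sup>2 + x\<^sup>2) - ln (s\<^sup>2 + t\<^sup>2))) has_real_derivative ?f s) (at s)" for s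
      proof -
        have frac: "2 * s / A - 2 * s / B = 2 * s * (B - A) / (A * B)" if "A \<noteq> 0" "B \<noteq> 0" for A B :: real
          using that by (simp add: field_simps)
        have "((\<lambda>s. ?c * (ln (s\<^sup>2 + x\<^sup>2) - ln (s\<^sup>2 + t\<^sup>2))) has_real_derivative
            ?c * (2 * s / (s\<^sup>2 + x\<^sup>2) - 2 * s / (s\<^sup>2 + t\<^sup>2))) (at s)"
          by (intro DERIV_cmult DERIV_diff ln_deriv) (rule nz)+
        also have "2 * s / (s\<^sup>2 + x\<^sup>2) - 2 * s / (s\<^sup>2 + t\<^sup>2)
            = 2 * s * (t\<^sup>2 - x\<^sup>2) / ((s\<^sup>2 + x\<^sup>2) * (s\<^sup>2 + t\<^sup>2))"
          by (subst frac) (use nz[of s] in \<open>linarith, linarith, simp\<close>)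
        also have "?c * \<dots> = ?f s"
          using False nz[of s] by (simp add: divide_simps add.commute)
        finally show ?thesis .
      qed
      have "((\<lambda>s. ln (s\<^sup>2 + x\<^sup>2) - ln (s\<^sup>2 + t\<^sup>2)) \<longlongrightarrow> 0) at_top"
        by real_asymp
      then show "((\<lambda>s. ?c * (ln (s\<^sup>2 + x\<^sup>2) - ln (s\<^sup>2 + t\<^sup>2))) \<longlongrightarrow> 0) at_top"
        by (rule tendsto_mult_right_zero)
    qed (use nonneg in auto)
    also have "0 - ?c * (ln (0\<^sup>2 + x\<^sup>2) - ln (0\<^sup>2 + t\<^sup>2)) = t / (2 * x\<^sup>2) * log_quot (t\<^sup>2 / x\<^sup>2)"
    proof -
      have "ln (t\<^sup>2 / x\<^sup>2) = ln (t\<^sup>2) - ln (x\<^sup>2)"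
        using x t by (simp add: ln_divide_pos)
      then have log_quot: "log_quot (t\<^sup>2 / x\<^sup>2) = (ln (t\<^sup>2) - ln (x\<^sup>2)) / ((t\<^sup>2 - x\<^sup>2) / x\<^sup>2)"
        using x False by (simp add: log_quot_def diff_divide_distrib)
      have alg: "0 - t / (2 * d) * (b - a) = t / (2 * c) * ((a - b) / (d / c))" if "c \<noteq> 0" "d \<noteq> 0" for a b c d
        using that by (simp add: field_simps)
      show ?thesis
        unfolding log_quot power_zero_numeral add_0 by (rule alg) (use x False in auto)
    qed
    finally show ?thesis .
  qed
qed

lemma nn_integral_cauchy_product:
  assumes x: "x \<noteq> 0" and t: "t > 0"
  shows "(\<integral>\<^sup>+ s. ennreal (s / (s\<^sup>2 + x\<^sup>2) * (t / (t\<^sup>2 + s\<^sup>2))) * indicator {0<..} s \<partial>lborel)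
       = ennreal (t / (2 * x\<^sup>2) * log_quot (t\<^sup>2 / x\<^sup>2))"
proof -
  have "(\<integral>\<^sup>+ s. ennreal (s / (s\<^sup>2 + x\<^sup>2) * (t / (t\<^sup>2 + s\<^sup>2))) * indicator {0<..} s \<partial>lborel)
      = (\<integral>\<^sup>+ s. ennreal (s / (s\<^sup>2 + x\<^sup>2) * (t / (t\<^sup>2 + s\<^sup>2))) * indicator {0..} s \<partial>lborel)"
    by (intro nn_integral_cong) (auto simp: indicator_def)
  then show ?thesis
    using nn_integral_cauchy_product_Ici[OF assms] by simp
qed

text \<open>Numerator and denominator have the same sign. Positivity lets \<open>enn2real\<close>
  recover the value of the integral.\<close>

lemma log_quot_pos: "w > 0 \<Longrightarrow> log_quot w > 0"
  by (cases "w < 1") (auto simp: log_quot_def divide_neg_neg)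

text \<open>All analytic facts about \<open>q\<close> are derived from this formula, which is
  uniform across the diagonal.\<close>

lemma q_eq_log_quot:
  assumes x: "x \<noteq> 0" and t: "t > 0"
  shows "q x t = t / (pi\<^sup>2 * x\<^sup>2) * log_quot (t\<^sup>2 / x\<^sup>2)"
proof -
  let ?f = "\<lambda>s. s / (s\<^sup>2 + x\<^sup>2) * (t / (t\<^sup>2 + s\<^sup>2))"
  have nonneg: "0 \<le> indicator {0<..} s * ?f s" for s :: real
    using t by (auto simp: indicator_def intro!: mult_nonneg_nonneg divide_nonneg_nonneg)
  have "(LBINT s:{0<..}. ?f s) = enn2real (\<integral>\<^sup>+ s. ennreal (indicator {0<..} s * ?f s) \<partial>lborel)"
    unfolding set_lebesgue_integral_def real_scaleR_def
    by (rule integral_eq_nn_integral) (use nonneg in auto)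
  also have "(\<integral>\<^sup>+ s. ennreal (indicator {0<..} s * ?f s) \<partial>lborel)
      = (\<integral>\<^sup>+ s. ennreal (?f s) * indicator {0<..} s \<partial>lborel)"
    by (intro nn_integral_cong) (auto simp: indicator_def)
  also have "enn2real \<dots> = t / (2 * x\<^sup>2) * log_quot (t\<^sup>2 / x\<^sup>2)"
    unfolding nn_integral_cauchy_product[OF assms] using assms log_quot_pos[of "t\<^sup>2 / x\<^sup>2"] by simp
  finally show ?thesis
    using x by (simp add: q_def)
qed

text \<open>The kernel is the density of the inner process at \<open>s\<close> times that of the
  outer process at time \<open>\<bar>s\<bar>\<close> and position \<open>x\<close>. The factor 2
  accounts for folding the real line onto the positive half-line, and the two factors
  \<open>1 / pi\<close> give the constant in \<open>q\<close>.\<close>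

lemma nn_integral_cauchy_kernel_q:
  assumes x: "x \<noteq> 0" and t: "t > 0"
  shows "2 * (\<integral>\<^sup>+ s. ennreal (t / (pi * (t\<^sup>2 + s\<^sup>2)) * (\<bar>s\<bar> / (pi * (s\<^sup>2 + x\<^sup>2)))) * indicator {0<..} s \<partial>lborel)
      = ennreal (q x t)"
proof -
  let ?f = "\<lambda>s. s / (s\<^sup>2 + x\<^sup>2) * (t / (t\<^sup>2 + s\<^sup>2))"
  have "ennreal (t / (pi * (t\<^sup>2 + s\<^sup>2)) * (\<bar>s\<bar> / (pi * (s\<^sup>2 + x\<^sup>2)))) * indicator {0<..} s
      = ennreal (1 / pi\<^sup>2) * (ennreal (?f s) * indicator {0<..} s)" for s :: real
  proof (cases "s > 0")
    case True
    then have "t / (pi * (t\<^sup>2 + s\<^sup>2)) * (\<bar>s\<bar> / (pi * (s\<^sup>2 + x\<^sup>2))) = 1 / pi\<^sup>2 * ?f s"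
      by (simp add: power2_eq_square[of pi] mult_ac)
    then show ?thesis
      using True by (simp flip: ennreal_mult')
  qed simp
  then have "(\<integral>\<^sup>+ s. ennreal (t / (pi * (t\<^sup>2 + s\<^sup>2)) * (\<bar>s\<bar> / (pi * (s\<^sup>2 + x\<^sup>2)))) * indicator {0<..} s \<partial>lborel)
      = ennreal (1 / pi\<^sup>2) * (\<integral>\<^sup>+ s. ennreal (?f s) * indicator {0<..} s \<partial>lborel)"
    by (simp only: nn_integral_cmult[symmetric]) (subst nn_integral_cmult[symmetric]; measurable)
  also have "\<dots> = ennreal (1 / pi\<^sup>2 * (t / (2 * x\<^sup>2) * log_quot (t\<^sup>2 / x\<^sup>2)))"
    unfolding nn_integral_cauchy_product[OF assms] by (rule ennreal_mult'[symmetric]) simp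
  also have "2 * \<dots> = ennreal (2 * (1 / pi\<^sup>2 * (t / (2 * x\<^sup>2) * log_quot (t\<^sup>2 / x\<^sup>2))))"
    by (subst ennreal_mult') simp_all
  also have "2 * (1 / pi\<^sup>2 * (t / (2 * x\<^sup>2) * log_quot (t\<^sup>2 / x\<^sup>2))) = q x t"
    unfolding q_eq_log_quot[OF assms] by simp
  finally show ?thesis .
qed

section \<open>Closed form, limit on the diagonal, and wave equation\<close>

lemma log_quot_closed_form:
  fixes x t :: real
  assumes "x \<noteq> 0" "t > 0" "\<bar>x\<bar> \<noteq> t"
  shows "t / (pi\<^sup>2 * x\<^sup>2) * log_quot (t\<^sup>2 / x\<^sup>2) = 2 * t / (pi\<^sup>2 * (t\<^sup>2 - x\<^sup>2)) * ln (t / \<bar>x\<bar>)"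
proof -
  have ne: "t\<^sup>2 \<noteq> x\<^sup>2"
    using assms by (auto simp: power2_eq_iff)
  have "ln (t\<^sup>2 / x\<^sup>2) = 2 * ln (t / \<bar>x\<bar>)"
    using assms ln_realpow[of "t / \<bar>x\<bar>" 2] by (simp add: power_divide)
  then have "log_quot (t\<^sup>2 / x\<^sup>2) = 2 * ln (t / \<bar>x\<bar>) / ((t\<^sup>2 - x\<^sup>2) / x\<^sup>2)"
    using assms ne by (simp add: log_quot_def diff_divide_distrib)
  then show ?thesis
    using assms ne by (simp add: field_simps)
qed

text \<open>Off the diagonals the closed form agrees with the expression in \<open>log_quot\<close>,
  which is jointly continuous wherever \<open>y\<close> is nonzero and \<open>s\<close> is positive.
  This makes the extension by continuity precise.\<close>

lemma q_limit_diagonal: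
  fixes x t :: real
  assumes x: "x \<noteq> 0" and t: "t > 0"
  shows "((\<lambda>(y, s). 2 * s / (pi\<^sup>2 * (s\<^sup>2 - y\<^sup>2)) * ln (s / \<bar>y\<bar>)) \<longlongrightarrow> q x t)
          (at (x, t) within {(y, s). y \<noteq> 0 \<and> s > 0 \<and> \<bar>y\<bar> \<noteq> s})"
proof -
  let ?D = "{(y, s). y \<noteq> 0 \<and> s > 0 \<and> \<bar>y\<bar> \<noteq> s} :: (real \<times> real) set"
  let ?g = "\<lambda>p::real \<times> real. snd p / (pi\<^sup>2 * (fst p)\<^sup>2) * log_quot ((snd p)\<^sup>2 / (fst p)\<^sup>2)"
  have "isCont log_quot (t\<^sup>2 / x\<^sup>2)"
    using assms by (intro isCont_log_quot) auto
  then have "((\<lambda>p. log_quot ((snd p)\<^sup>2 / (fst p)\<^sup>2)) \<longlongrightarrow> log_quot (t\<^sup>2 / x\<^sup>2)) (at (x, t) within ?D)"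
    by (rule isCont_tendsto_compose) (use x in \<open>auto intro!: tendsto_eq_intros\<close>)
  then have "(?g \<longlongrightarrow> q x t) (at (x, t) within ?D)"
    using assms by (auto simp: q_eq_log_quot intro!: tendsto_eq_intros)
  moreover have "\<forall>\<^sub>F p in at (x, t) within ?D.
      ?g p = (case p of (y, s) \<Rightarrow> 2 * s / (pi\<^sup>2 * (s\<^sup>2 - y\<^sup>2)) * ln (s / \<bar>y\<bar>))"
    unfolding eventually_at_filter
    by (auto intro!: always_eventually log_quot_closed_form
        simp del: times_divide_eq_left times_divide_eq_right)
  ultimately show ?thesis
    by (rule Lim_transform_eventually)
qed

text \<open>An explicit first derivative on a whole open set replaces \<open>deriv f\<close> near
  the point, so that it can be differentiated again.\<close>

lemma has_real_derivative_deriv_eqI: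
  assumes "open S" "x \<in> S"
    and "\<And>y. y \<in> S \<Longrightarrow> (f has_real_derivative f' y) (at y)"
    and "(f' has_real_derivative d) (at x)"
  shows "(deriv f has_real_derivative d) (at x)"
proof (rule has_field_derivative_transform_within_open)
  show "(f' has_real_derivative d) (at x)" by fact
  show "\<And>y. y \<in> S \<Longrightarrow> f' y = deriv f y"
    using assms(3) by (metis DERIV_imp_deriv)
qed fact+

lemma q_wave_equation:
  assumes x: "x \<noteq> 0" and t: "t > 0"
  shows "(\<lambda>s. q x s) differentiable (at t)"
    and "deriv (\<lambda>s. q x s) differentiable (at t)"
    and "(\<lambda>y. q y t) differentiable (at x)"
    and "deriv (\<lambda>y. q y t) differentiable (at x)"
    and "deriv (deriv (\<lambda>s. q x s)) t = deriv (deriv (\<lambda>y. q y t)) x - 2 / (pi\<^sup>2 * t * x\<^sup>2)"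
proof -
  obtain f' f'' where
    D1: "\<And>w. w > 0 \<Longrightarrow> (log_quot has_real_derivative f' w) (at w)" and
    D2: "\<And>w. w > 0 \<Longrightarrow> (f' has_real_derivative f'' w) (at w)"
    using log_quot_twice_differentiable by blast
  have C1: "((\<lambda>s. log_quot (g s)) has_real_derivative f' (g s) * g') (at s)"
    if "(g has_real_derivative g') (at s)" "g s > 0" for g g' s
    using DERIV_chain2[OF D1[OF that(2)] that(1)] .
  have C2: "((\<lambda>s. f' (g s)) has_real_derivative f'' (g s) * g') (at s)"
    if "(g has_real_derivative g') (at s)" "g s > 0" for g g' s
    using DERIV_chain2[OF D2[OF that(2)] that(1)] .
  have T0: "((\<lambda>s. log_quot (s\<^sup>2 / x\<^sup>2)) has_real_derivative f' (s\<^sup>2 / x\<^sup>2) * (2 * s / x\<^sup>2)) (at s)"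
    "((\<lambda>s. f' (s\<^sup>2 / x\<^sup>2)) has_real_derivative f'' (s\<^sup>2 / x\<^sup>2) * (2 * s / x\<^sup>2)) (at s)"
    if "s > 0" for s
  proof -
    have pos: "0 < s\<^sup>2 / x\<^sup>2"
      using that x by simp
    have "((\<lambda>s. s\<^sup>2 / x\<^sup>2) has_real_derivative 2 * s / x\<^sup>2) (at s)"
      by (intro DERIV_cdivide) (auto intro!: derivative_eq_intros)
    then show "((\<lambda>s. log_quot (s\<^sup>2 / x\<^sup>2)) has_real_derivative f' (s\<^sup>2 / x\<^sup>2) * (2 * s / x\<^sup>2)) (at s)"
      "((\<lambda>s. f' (s\<^sup>2 / x\<^sup>2)) has_real_derivative f'' (s\<^sup>2 / x\<^sup>2) * (2 * s / x\<^sup>2)) (at s)"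
      using pos by (rule C1, rule C2)
  qed
  have X0: "((\<lambda>y. log_quot (t\<^sup>2 / y\<^sup>2)) has_real_derivative f' (t\<^sup>2 / y\<^sup>2) * (- 2 * t\<^sup>2 / y ^ 3)) (at y)"
    "((\<lambda>y. f' (t\<^sup>2 / y\<^sup>2)) has_real_derivative f'' (t\<^sup>2 / y\<^sup>2) * (- 2 * t\<^sup>2 / y ^ 3)) (at y)"
    if "y \<noteq> 0" for y
  proof -
    have pos: "0 < t\<^sup>2 / y\<^sup>2"
      using that t by simp
    have "((\<lambda>y. t\<^sup>2 / y\<^sup>2) has_real_derivative - 2 * t\<^sup>2 / y ^ 3) (at y)"
      using that by (auto intro!: derivative_eq_intros simp: eval_nat_numeral field_simps)
    then show "((\<lambda>y. log_quot (t\<^sup>2 / y\<^sup>2)) has_real_derivative f' (t\<^sup>2 / y\<^sup>2) * (- 2 * t\<^sup>2 / y ^ 3)) (at y)"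
      "((\<lambda>y. f' (t\<^sup>2 / y\<^sup>2)) has_real_derivative f'' (t\<^sup>2 / y\<^sup>2) * (- 2 * t\<^sup>2 / y ^ 3)) (at y)"
      using pos by (rule C1, rule C2)
  qed
  let ?t1 = "\<lambda>s. log_quot (s\<^sup>2 / x\<^sup>2) / (pi\<^sup>2 * x\<^sup>2) + 2 * s\<^sup>2 * f' (s\<^sup>2 / x\<^sup>2) / (pi\<^sup>2 * x ^ 4)"
  let ?x1 = "\<lambda>y. - 2 * t * log_quot (t\<^sup>2 / y\<^sup>2) / (pi\<^sup>2 * y ^ 3) - 2 * t ^ 3 * f' (t\<^sup>2 / y\<^sup>2) / (pi\<^sup>2 * y ^ 5)"
  \<comment> \<open>Writing both second derivatives in terms of \<open>w\<close> reduces the wave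
    equation to a relation between \<open>log_quot\<close>, \<open>f'\<close> and \<open>f''\<close>
    at one point.\<close>
  define w where "w = t\<^sup>2 / x\<^sup>2"
  have w: "w > 0" using assms by (simp add: w_def)
  define t2 where "t2 = 6 * t * f' w / (pi\<^sup>2 * x ^ 4) + 4 * t ^ 3 * f'' w / (pi\<^sup>2 * x ^ 6)"
  define x2 where "x2 = 6 * t * log_quot w / (pi\<^sup>2 * x ^ 4) + 14 * t ^ 3 * f' w / (pi\<^sup>2 * x ^ 6)
    + 4 * t ^ 5 * f'' w / (pi\<^sup>2 * x ^ 8)"
  have T1: "((\<lambda>s. q x s) has_real_derivative ?t1 s) (at s)" if "s \<in> {0<..}" for s
  proof (rule has_field_derivative_transform_within_open[where S = "{0<..}"])
    show "((\<lambda>s. s / (pi\<^sup>2 * x\<^sup>2) * log_quot (s\<^sup>2 / x\<^sup>2)) has_real_derivative ?t1 s) (at s)"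
      using that x by (auto intro!: derivative_eq_intros T0) (simp add: field_simps eval_nat_numeral)
  qed (use that x in \<open>auto simp: q_eq_log_quot\<close>)
  have X1: "((\<lambda>y. q y t) has_real_derivative ?x1 y) (at y)" if "y \<in> - {0}" for y
  proof (rule has_field_derivative_transform_within_open[where S = "- {0}"])
    show "((\<lambda>y. t / (pi\<^sup>2 * y\<^sup>2) * log_quot (t\<^sup>2 / y\<^sup>2)) has_real_derivative ?x1 y) (at y)"
      using that t by (auto intro!: derivative_eq_intros X0) (simp add: field_simps eval_nat_numeral)
  qed (use that t in \<open>auto simp: q_eq_log_quot\<close>)
  have T2: "(deriv (\<lambda>s. q x s) has_real_derivative t2) (at t)"
  proof (rule has_real_derivative_deriv_eqI[where S = "{0<..}", OF _ _ T1])
    show "(?t1 has_real_derivative t2) (at t)"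
      using assms by (auto intro!: derivative_eq_intros T0) (simp add: t2_def w_def field_simps eval_nat_numeral)
  qed (use t in auto)
  have X2: "(deriv (\<lambda>y. q y t) has_real_derivative x2) (at x)"
  proof (rule has_real_derivative_deriv_eqI[where S = "- {0}", OF _ _ X1])
    show "(?x1 has_real_derivative x2) (at x)"
      using assms by (auto intro!: derivative_eq_intros X0) (simp add: x2_def w_def field_simps eval_nat_numeral)
  qed (use x in auto)
  have ids: "(w - 1) * f'' w + 2 * f' w = - 1 / w\<^sup>2" "(w - 1) * f' w + log_quot w = 1 / w"
    by (rule log_quot_derivative_identities[OF D1 D2 w]; assumption)+
  have "t2 - x2 = t / (pi\<^sup>2 * x ^ 4) *
      (6 * f' w + 4 * w * f'' w - 6 * log_quot w - 14 * w * f' w - 4 * w\<^sup>2 * f'' w)"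
    using x by (simp add: t2_def x2_def w_def field_simps eval_nat_numeral)
  \<comment> \<open>The \<open>f''\<close> terms force the coefficient \<open>- 4 * w\<close> on the
    second identity, and the \<open>log_quot\<close> term forces \<open>- 6\<close> on the first;
    the \<open>f'\<close> terms then match. The right-hand sides add up to
    \<open>4 / w - 6 / w\<close>.\<close>
  also have "6 * f' w + 4 * w * f'' w - 6 * log_quot w - 14 * w * f' w - 4 * w\<^sup>2 * f'' w
      = - 4 * w * ((w - 1) * f'' w + 2 * f' w) - 6 * ((w - 1) * f' w + log_quot w)"
    by (simp add: algebra_simps power2_eq_square)
  also have "\<dots> = - 2 / w"
    by (subst ids(1), subst ids(2)) (use w in \<open>simp add: field_simps power2_eq_square\<close>)
  also have "t / (pi\<^sup>2 * x ^ 4) * (- 2 / w) = - 2 / (pi\<^sup>2 * t * x\<^sup>2)"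
    using assms by (simp add: w_def field_simps eval_nat_numeral)
  finally have "t2 = x2 - 2 / (pi\<^sup>2 * t * x\<^sup>2)" by simp
  then show "deriv (deriv (\<lambda>s. q x s)) t = deriv (deriv (\<lambda>y. q y t)) x - 2 / (pi\<^sup>2 * t * x\<^sup>2)"
    using T2 X2 by (simp add: DERIV_imp_deriv)
  show "(\<lambda>s. q x s) differentiable (at t)" "deriv (\<lambda>s. q x s) differentiable (at t)"
    "(\<lambda>y. q y t) differentiable (at x)" "deriv (\<lambda>y. q y t) differentiable (at x)"
    using T1[of t] T2 X1[of x] X2 assms by (auto simp: real_differentiable_def)
qed

section \<open>The law of the iterated process\<close>

lemma nn_integral_even_function:
  fixes h :: "real \<Rightarrow> ennreal"
  assumes [measurable]: "h \<in> borel_measurable borel" and even: "\<And>s. h (- s) = h s"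
  shows "(\<integral>\<^sup>+ s. h s \<partial>lborel) = 2 * (\<integral>\<^sup>+ s. h s * indicator {0<..} s \<partial>lborel)"
proof -
  have "(\<integral>\<^sup>+ s. h s \<partial>lborel) = (\<integral>\<^sup>+ s. h s * indicator {0<..} s + h s * indicator {..<0} s \<partial>lborel)"
    by (rule nn_integral_cong_AE, use AE_lborel_singleton[of 0] in eventually_elim)
      (auto simp: indicator_def)
  also have "\<dots> = (\<integral>\<^sup>+ s. h s * indicator {0<..} s \<partial>lborel) + (\<integral>\<^sup>+ s. h s * indicator {..<0} s \<partial>lborel)"
    by (rule nn_integral_add) auto
  also have "(\<integral>\<^sup>+ s. h s * indicator {..<0} s \<partial>lborel) = (\<integral>\<^sup>+ s. h s * indicator {0<..} s \<partial>lborel)"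
    by (subst nn_integral_real_affine[where c = "- 1" and t = 0])
      (auto simp: even indicator_def intro!: nn_integral_cong)
  finally show ?thesis
    by (simp add: mult_2)
qed

text \<open>Tonelli's theorem moves the integral over the time \<open>s\<close> inside, where the
  kernel is even in \<open>s\<close> and integrates to \<open>q\<close>. The point
  \<open>x = 0\<close>, at which \<open>q\<close> is only a default value, is a null set.\<close>

lemma nn_integral_cauchy_mixture:
  assumes t: "t > 0" and [measurable]: "f \<in> borel_measurable borel"
  shows "(\<integral>\<^sup>+ s. ennreal (t / (pi * (t\<^sup>2 + s\<^sup>2))) *
            (\<integral>\<^sup>+ x. ennreal (\<bar>s\<bar> / (pi * (s\<^sup>2 + x\<^sup>2))) * f x \<partial>lborel) \<partial>lborel)
       = (\<integral>\<^sup>+ x. ennreal (q x t) * f x \<partial>lborel)"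
proof -
  let ?k = "\<lambda>s x. t / (pi * (t\<^sup>2 + s\<^sup>2)) * (\<bar>s\<bar> / (pi * (s\<^sup>2 + x\<^sup>2)))"
  have "(\<integral>\<^sup>+ s. ennreal (t / (pi * (t\<^sup>2 + s\<^sup>2))) *
            (\<integral>\<^sup>+ x. ennreal (\<bar>s\<bar> / (pi * (s\<^sup>2 + x\<^sup>2))) * f x \<partial>lborel) \<partial>lborel)
      = (\<integral>\<^sup>+ s. \<integral>\<^sup>+ x. ennreal (?k s x) * f x \<partial>lborel \<partial>lborel)"
    using t by (subst nn_integral_cmult[symmetric]) (auto simp: ennreal_mult' mult_ac simp del: times_divide_eq_left times_divide_eq_right)
  also have "\<dots> = (\<integral>\<^sup>+ x. \<integral>\<^sup>+ s. ennreal (?k s x) * f x \<partial>lborel \<partial>lborel)"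
    by (rule lborel_pair.Fubini') measurable
  also have "\<dots> = (\<integral>\<^sup>+ x. ennreal (q x t) * f x \<partial>lborel)"
  proof (rule nn_integral_cong_AE, use AE_lborel_singleton[of 0] in eventually_elim)
    fix x :: real
    assume x: "x \<noteq> 0"
    have "(\<integral>\<^sup>+ s. ennreal (?k s x) * f x \<partial>lborel) = (\<integral>\<^sup>+ s. ennreal (?k s x) \<partial>lborel) * f x"
      by (rule nn_integral_multc) measurable
    also have "(\<integral>\<^sup>+ s. ennreal (?k s x) \<partial>lborel)
        = 2 * (\<integral>\<^sup>+ s. ennreal (?k s x) * indicator {0<..} s \<partial>lborel)"
      by (rule nn_integral_even_function) auto
    also have "\<dots> = ennreal (q x t)"
      by (rule nn_integral_cauchy_kernel_q[OF x t])
    finally show "(\<integral>\<^sup>+ s. ennreal (?k s x) * f x \<partial>lborel) = ennreal (q x t) * f x" .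
  qed
  finally show ?thesis .
qed

text \<open>Open half-lines determine the measure, and their indicators are increasing limits of
  continuous functions, so monotone convergence applies to both measures. Continuous test functions
  are the ones that survive the limit along the rounded times.\<close>

lemma measure_eqI_continuous_nn_integral:
  fixes M N :: "real measure"
  assumes sets [measurable_cong]: "sets M = sets borel" "sets N = sets borel"
    and "finite_measure M"
    and eq: "\<And>f :: real \<Rightarrow> real. continuous_on UNIV f \<Longrightarrow> (\<And>x. 0 \<le> f x \<and> f x \<le> 1) \<Longrightarrow>
      (\<integral>\<^sup>+ x. ennreal (f x) \<partial>M) = (\<integral>\<^sup>+ x. ennreal (f x) \<partial>N)"
  shows "M = N"
proof (rule measure_eqI_lessThan[OF sets])
  interpret finite_measure M by fact
  fix a :: real
  show "emeasure M {a<..} < \<infinity>"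
    by (simp add: emeasure_eq_measure)
  \<comment> \<open>A ramp rising from 0 at \<open>a\<close> to 1 at \<open>a + 1/k\<close> when
    \<open>k > 0\<close>; it vanishes at \<open>a\<close>, as the open half-line requires.\<close>
  let ?f = "\<lambda>(k::nat) x. max 0 (min 1 (real k * (x - a)))"
  have lim: "(\<lambda>k. \<integral>\<^sup>+ x. ennreal (?f k x) \<partial>L) \<longlonglongrightarrow> emeasure L {a<..}"
    if L [measurable_cong]: "sets L = sets borel" for L
  proof -
    have "(\<lambda>k. \<integral>\<^sup>+ x. ennreal (?f k x) \<partial>L) \<longlonglongrightarrow> (\<integral>\<^sup>+ x. indicator {a<..} x \<partial>L)"
    proof (rule nn_integral_LIMSEQ)
      have "?f i x \<le> ?f j x" if "i \<le> j" for i j x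
      proof (cases "x \<le> a")
        case True
        then have "real i * (x - a) \<le> 0" "real j * (x - a) \<le> 0"
          by (auto intro: mult_nonneg_nonpos)
        then show ?thesis by simp
      next
        case False
        then have "real i * (x - a) \<le> real j * (x - a)"
          using that by (intro mult_right_mono) auto
        then show ?thesis by linarith
      qed
      then show "incseq (\<lambda>k x. ennreal (?f k x))"
        unfolding incseq_def le_fun_def by (blast intro: ennreal_leI)
      show "(\<lambda>x. ennreal (?f k x)) \<in> borel_measurable L" for k
        by measurable
      show "(\<lambda>k. ennreal (?f k x)) \<longlonglongrightarrow> indicator {a<..} x" for x
      proof (cases "x \<le> a")
        case True
        then have "?f k x = 0" for k
          using mult_nonneg_nonpos[of "real k" "x - a"] by simp
        then show ?thesis
          using True by simp
      next
        case False
        then have "filterlim (\<lambda>k. (x - a) * real k) at_top sequentially"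
          by (intro filterlim_tendsto_pos_mult_at_top[OF tendsto_const _ filterlim_real_sequentially]) auto
        then have "\<forall>\<^sub>F k in sequentially. 1 \<le> (x - a) * real k"
          by (auto simp: filterlim_at_top)
        then have "\<forall>\<^sub>F k in sequentially. ennreal (?f k x) = indicator {a<..} x"
          by eventually_elim (use False in \<open>simp add: mult.commute min_def\<close>)
        then show ?thesis
          by (rule tendsto_eventually)
      qed
    qed
    then show ?thesis
      by (simp add: L)
  qed
  have "(\<integral>\<^sup>+ x. ennreal (?f k x) \<partial>M) = (\<integral>\<^sup>+ x. ennreal (?f k x) \<partial>N)" for k
    by (rule eq) (auto intro!: continuous_intros)
  then show "emeasure M {a<..} = emeasure N {a<..}"
    using LIMSEQ_unique[OF lim[OF sets(1)]] lim[OF sets(2)] by simp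
qed

section \<open>Measurability in the completion, and rounding of times\<close>

lemma (in complete_measure) measurable_AE_eq:
  assumes f: "f \<in> measurable M N" and ae: "AE x in M. f x = g x"
    and g: "g \<in> space M \<rightarrow> space N"
  shows "g \<in> measurable M N"
proof (rule measurableI)
  fix A assume A: "A \<in> sets N"
  show "g -` A \<inter> space M \<in> sets M"
  \<comment> \<open>The preimages under \<open>f\<close> and \<open>g\<close> differ only by a null
    set, which completeness makes harmless.\<close>
  proof (rule in_sets_AE)
    show "AE x in M. x \<in> f -` A \<inter> space M \<longleftrightarrow> x \<in> g -` A \<inter> space M"
      using ae by eventually_elim auto
  qed (use measurable_sets[OF f A] in auto)
qed (use g in auto)

text \<open>Floor plus one, rather than ceiling, gives a lattice point strictly above
  \<open>s\<close> for \<open>s\<close> nonnegative, even when \<open>s\<close> lies on the lattice;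
  hence the approach is within \<open>at_right s\<close>. The natural-number floor leaves countably
  many values, all of them valid times.\<close>

definition round_up :: "nat \<Rightarrow> real \<Rightarrow> real" where
  "round_up n s = (real (nat \<lfloor>real (Suc n) * s\<rfloor>) + 1) / real (Suc n)"

lemma round_up_nonneg: "0 \<le> round_up n s"
  by (simp add: round_up_def)

lemma round_up_bounds:
  assumes "0 \<le> s"
  shows "s < round_up n s" "round_up n s \<le> s + 1 / real (Suc n)"
proof -
  have "real (nat \<lfloor>real (Suc n) * s\<rfloor>) \<le> real (Suc n) * s"
    by (rule of_nat_floor) (use assms in simp)
  moreover have "real (Suc n) * s < real (nat \<lfloor>real (Suc n) * s\<rfloor>) + 1"
    by linarith
  ultimately show "s < round_up n s" "round_up n s \<le> s + 1 / real (Suc n)"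
    unfolding round_up_def by (simp_all add: field_simps del: of_nat_Suc)
qed

lemma round_up_at_right:
  assumes "0 \<le> s"
  shows "filterlim (\<lambda>n. round_up n s) (at_right s) sequentially"
proof -
  have "(\<lambda>n. round_up n s) \<longlonglongrightarrow> s"
  proof (rule tendsto_sandwich[where f = "\<lambda>_. s"])
    show "(\<lambda>n. s + 1 / real (Suc n)) \<longlonglongrightarrow> s"
      using tendsto_add[OF tendsto_const[of s] LIMSEQ_inverse_real_of_nat] by (simp add: inverse_eq_divide)
    show "\<forall>\<^sub>F n in sequentially. s \<le> round_up n s"
      using round_up_bounds(1)[OF assms] by (simp add: less_imp_le)
    show "\<forall>\<^sub>F n in sequentially. round_up n s \<le> s + 1 / real (Suc n)"
      using round_up_bounds(2)[OF assms] by (intro always_eventually allI)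
  qed (rule tendsto_const)
  moreover have "round_up n s \<in> {s<..} \<and> round_up n s \<noteq> s" for n
    using round_up_bounds(1)[OF assms, of n] by simp
  ultimately show ?thesis
    unfolding filterlim_at by (auto intro!: always_eventually)
qed

text \<open>A rounded time takes countably many values, so measurability at each fixed time suffices
  and joint measurability in time and state is avoided.\<close>

lemma measurable_round_up_compose:
  assumes f: "\<And>u. 0 \<le> u \<Longrightarrow> (\<lambda>x. f u x) \<in> measurable M N"
    and [measurable]: "g \<in> borel_measurable M"
  shows "(\<lambda>x. f (round_up n (g x)) x) \<in> measurable M N"
  unfolding round_up_def
proof (rule measurable_compose_countable[where g = "\<lambda>x. nat \<lfloor>real (Suc n) * g x\<rfloor>"
      and f = "\<lambda>k. f ((real k + 1) / real (Suc n))"])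
  show "(\<lambda>x. nat \<lfloor>real (Suc n) * g x\<rfloor>) \<in> measurable M (count_space UNIV)"
    by measurable
qed (auto intro!: f)

lemma cadlag_round_up:
  assumes "cadlag x" "0 \<le> s"
  shows "(\<lambda>n. x (round_up n s)) \<longlonglongrightarrow> x s"
proof -
  have "(x \<longlongrightarrow> x s) (at_right s)"
    using assms by (auto simp: cadlag_def continuous_within)
  then show ?thesis
    using round_up_at_right[OF assms(2)] by (rule filterlim_compose)
qed

section \<open>Evaluation of a cadlag process at a random time\<close>

locale cadlag_process = prob_space +
  fixes X :: "real \<Rightarrow> 'a \<Rightarrow> real"
  assumes measurable_X: "\<And>t. 0 \<le> t \<Longrightarrow> X t \<in> borel_measurable M"
    and cadlag_X: "AE \<omega> in M. cadlag (\<lambda>t. X t \<omega>)"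
begin

lemma subordinated_approx:
  "AE \<omega> in M. (\<lambda>n. X (round_up n \<bar>T \<omega>\<bar>) \<omega>) \<longlonglongrightarrow> X \<bar>T \<omega>\<bar> \<omega>"
  using cadlag_X by eventually_elim (auto intro: cadlag_round_up)

lemma measurable_subordinated_approx:
  assumes [measurable]: "T \<in> borel_measurable M"
  shows "(\<lambda>\<omega>. X (round_up n \<bar>T \<omega>\<bar>) \<omega>) \<in> borel_measurable M"
  by (rule measurable_round_up_compose[where f = X and g = "\<lambda>\<omega>. \<bar>T \<omega>\<bar>"]) (auto intro: measurable_X)

text \<open>The pathwise \<open>lim\<close> of the approximations is measurable for
  \<open>M\<close>, but agrees with the process at the random time only almost surely, hence the
  completion.\<close>

lemma measurable_subordinated:
  assumes T: "T \<in> borel_measurable M"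
  shows "(\<lambda>\<omega>. X \<bar>T \<omega>\<bar> \<omega>) \<in> borel_measurable (completion M)"
proof (rule completion.measurable_AE_eq)
  show "(\<lambda>\<omega>. lim (\<lambda>n. X (round_up n \<bar>T \<omega>\<bar>) \<omega>)) \<in> borel_measurable (completion M)"
    by (intro measurable_completion borel_measurable_lim_metric measurable_subordinated_approx T)
  show "AE \<omega> in completion M. lim (\<lambda>n. X (round_up n \<bar>T \<omega>\<bar>) \<omega>) = X \<bar>T \<omega>\<bar> \<omega>"
    using subordinated_approx[of T] unfolding AE_completion_iff by eventually_elim (rule limI)
qed auto

text \<open>
  At the discrete times \<open>round_up n \<bar>Y t\<bar>\<close> the identity is Fubini's theorem on the product of the two
  path spaces; right continuity of the paths carries it to the limit.
\<close>
lemma nn_integral_subordinated: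
  assumes indep: "indep_processes M X Y" and t: "0 \<le> t"
    and f: "continuous_on UNIV f" "\<And>x. 0 \<le> f x \<and> f x \<le> 1"
  shows "(\<lambda>y. \<integral>\<^sup>+ \<omega>. ennreal (f (X \<bar>y\<bar> \<omega>)) \<partial>M) \<in> borel_measurable borel"
    and "(\<integral>\<^sup>+ \<omega>. ennreal (f (X \<bar>Y t \<omega>\<bar> \<omega>)) \<partial>completion M)
       = (\<integral>\<^sup>+ \<omega>'. (\<integral>\<^sup>+ \<omega>. ennreal (f (X \<bar>Y t \<omega>'\<bar> \<omega>)) \<partial>M) \<partial>M)"
proof -
  let ?P = "PiM {0..} (\<lambda>_. borel) :: (real \<Rightarrow> real) measure"
  let ?X = "\<lambda>\<omega>. \<lambda>t\<in>{0..}. X t \<omega>"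
  let ?Y = "\<lambda>\<omega>. \<lambda>t\<in>{0..}. Y t \<omega>"
  let ?G = "\<lambda>u. \<integral>\<^sup>+ \<omega>. ennreal (f (X u \<omega>)) \<partial>M"
  note [measurable] = borel_measurable_continuous_onI[OF f(1)]
  have X [measurable]: "?X \<in> measurable M ?P" and Y [measurable]: "?Y \<in> measurable M ?P"
    and joint: "distr M ?P ?X \<Otimes>\<^sub>M distr M ?P ?Y = distr M (?P \<Otimes>\<^sub>M ?P) (\<lambda>\<omega>. (?X \<omega>, ?Y \<omega>))"
    using indep by (auto simp: indep_processes_def indep_var_distribution_eq)
  have eval: "(\<lambda>p. p t) \<in> borel_measurable ?P"
    using t by (intro measurable_component_singleton) auto
  have T [measurable]: "Y t \<in> borel_measurable M"
    using measurable_compose[OF Y eval] t by simp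
  interpret PX: prob_space "distr M ?P ?X"
    by (rule prob_space_distr) (rule X)
  interpret PY: prob_space "distr M ?P ?Y"
    by (rule prob_space_distr) (rule Y)
  interpret pair_sigma_finite "distr M ?P ?X" "distr M ?P ?Y" ..
  interpret cM: prob_space "completion M"
    by (rule prob_spaceI) (simp add: emeasure_space_1)
  have cont: "(\<lambda>n. ennreal (f (x n))) \<longlonglongrightarrow> ennreal (f l)" if "x \<longlonglongrightarrow> l" for x l
    using that f(1) by (intro tendsto_ennrealI isCont_tendsto_compose[of l f])
      (auto simp: continuous_on_eq_continuous_at)
  have G_meas: "(\<lambda>y. ?G (round_up n \<bar>y\<bar>)) \<in> borel_measurable borel" for n
    by (rule measurable_round_up_compose[where f = "\<lambda>u _. ?G u"]) auto
  have G_lim: "(\<lambda>n. ?G (round_up n \<bar>y\<bar>)) \<longlonglongrightarrow> ?G \<bar>y\<bar>" for y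
  proof (rule nn_integral_dominated_convergence[where w = "\<lambda>_. 1"])
    show "AE \<omega> in M. (\<lambda>n. ennreal (f (X (round_up n \<bar>y\<bar>) \<omega>))) \<longlonglongrightarrow> ennreal (f (X \<bar>y\<bar> \<omega>))"
      using subordinated_approx[of "\<lambda>_. y"] by eventually_elim (rule cont)
  qed (use f(2) round_up_nonneg in \<open>auto simp: emeasure_space_1 intro!: measurable_compose[OF measurable_X] ennreal_le_1[THEN iffD2]\<close>)
  \<comment> \<open>Right continuity makes this a pointwise limit of functions that depend on
    \<open>y\<close> through its rounding only.\<close>
  show G: "(\<lambda>y. ?G \<bar>y\<bar>) \<in> borel_measurable borel"
    by (rule borel_measurable_LIMSEQ_order[OF G_lim G_meas])
  have "(\<lambda>n. \<integral>\<^sup>+ \<omega>. ennreal (f (X (round_up n \<bar>Y t \<omega>\<bar>) \<omega>)) \<partial>completion M)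
      \<longlonglongrightarrow> (\<integral>\<^sup>+ \<omega>. ennreal (f (X \<bar>Y t \<omega>\<bar> \<omega>)) \<partial>completion M)"
  proof (rule nn_integral_dominated_convergence[where w = "\<lambda>_. 1"])
    show "AE \<omega> in completion M. (\<lambda>n. ennreal (f (X (round_up n \<bar>Y t \<omega>\<bar>) \<omega>))) \<longlonglongrightarrow> ennreal (f (X \<bar>Y t \<omega>\<bar> \<omega>))"
      using subordinated_approx[of "Y t"] unfolding AE_completion_iff by eventually_elim (rule cont)
    show "(\<lambda>\<omega>. ennreal (f (X (round_up n \<bar>Y t \<omega>\<bar>) \<omega>))) \<in> borel_measurable (completion M)" for n
      by (rule measurable_completion, rule measurable_compose[OF measurable_subordinated_approx[OF T]])
        measurable
    show "(\<lambda>\<omega>. ennreal (f (X \<bar>Y t \<omega>\<bar> \<omega>))) \<in> borel_measurable (completion M)"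
      by (rule measurable_compose[OF measurable_subordinated[OF T]]) measurable
  qed (use f(2) in \<open>auto simp: emeasure_space_1\<close>)
  moreover have "(\<integral>\<^sup>+ \<omega>. ennreal (f (X (round_up n \<bar>Y t \<omega>\<bar>) \<omega>)) \<partial>completion M)
      = (\<integral>\<^sup>+ \<omega>. ?G (round_up n \<bar>Y t \<omega>\<bar>) \<partial>M)" for n
  proof -
    \<comment> \<open>The rounded process as a functional of the pair of paths. It is measurable for
      the product sigma-algebra since only countably many coordinates of the first path are
      read.\<close>
    let ?F = "\<lambda>z::(real \<Rightarrow> real) \<times> (real \<Rightarrow> real). ennreal (f (fst z (round_up n \<bar>snd z t\<bar>)))"
    have F: "?F \<in> borel_measurable (?P \<Otimes>\<^sub>M ?P)"
    proof (rule measurable_round_up_compose[where f = "\<lambda>u z. ennreal (f (fst z u))"])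
      show "(\<lambda>z. ennreal (f (fst z u))) \<in> borel_measurable (?P \<Otimes>\<^sub>M ?P)" if "0 \<le> u" for u
        using that by (intro measurable_compose[OF measurable_compose[OF measurable_fst
              measurable_component_singleton]]) auto
      show "(\<lambda>z. \<bar>snd z t\<bar>) \<in> borel_measurable (?P \<Otimes>\<^sub>M ?P)"
        using measurable_compose[OF measurable_snd eval] by measurable
    qed
    have "(\<integral>\<^sup>+ \<omega>. ennreal (f (X (round_up n \<bar>Y t \<omega>\<bar>) \<omega>)) \<partial>completion M)
        = (\<integral>\<^sup>+ \<omega>. ?F (?X \<omega>, ?Y \<omega>) \<partial>M)"
      unfolding nn_integral_completion using t by (simp add: round_up_nonneg)
    also have "\<dots> = (\<integral>\<^sup>+ z. ?F z \<partial>(distr M ?P ?X \<Otimes>\<^sub>M distr M ?P ?Y))"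
      unfolding joint by (rule nn_integral_distr[symmetric]) (use F in measurable)
    also have "\<dots> = (\<integral>\<^sup>+ y. \<integral>\<^sup>+ x. ?F (x, y) \<partial>distr M ?P ?X \<partial>distr M ?P ?Y)"
      by (rule nn_integral_snd[symmetric]) (use F in measurable)
    also have "\<dots> = (\<integral>\<^sup>+ y. ?G (round_up n \<bar>y t\<bar>) \<partial>distr M ?P ?Y)"
    proof (rule nn_integral_cong)
      fix y assume "y \<in> space (distr M ?P ?Y)"
      then have y: "y \<in> space ?P" by simp
      have "(\<integral>\<^sup>+ x. ?F (x, y) \<partial>distr M ?P ?X) = (\<integral>\<^sup>+ \<omega>. ?F (?X \<omega>, y) \<partial>M)"
        by (rule nn_integral_distr[OF X])
          (use measurable_compose[OF measurable_Pair2'[OF y] F] in simp)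
      then show "(\<integral>\<^sup>+ x. ?F (x, y) \<partial>distr M ?P ?X) = ?G (round_up n \<bar>y t\<bar>)"
        by (simp add: round_up_nonneg)
    qed
    also have "\<dots> = (\<integral>\<^sup>+ \<omega>. ?G (round_up n \<bar>?Y \<omega> t\<bar>) \<partial>M)"
      by (rule nn_integral_distr[OF Y]) (use measurable_compose[OF eval G_meas[of n]] in simp)
    finally show ?thesis
      using t by simp
  qed
  \<comment> \<open>The same sequence of integrals is now computed in two ways: its limit under the
    completion, just obtained, and its limit through \<open>G_lim\<close> below.\<close>
  ultimately have "(\<lambda>n. \<integral>\<^sup>+ \<omega>. ?G (round_up n \<bar>Y t \<omega>\<bar>) \<partial>M)
      \<longlonglongrightarrow> (\<integral>\<^sup>+ \<omega>. ennreal (f (X \<bar>Y t \<omega>\<bar> \<omega>)) \<partial>completion M)"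
    by simp
  moreover have "(\<lambda>n. \<integral>\<^sup>+ \<omega>. ?G (round_up n \<bar>Y t \<omega>\<bar>) \<partial>M)
      \<longlonglongrightarrow> (\<integral>\<^sup>+ \<omega>. ?G \<bar>Y t \<omega>\<bar> \<partial>M)"
  proof (rule nn_integral_dominated_convergence[where w = "\<lambda>_. 1"])
    have "?G u \<le> 1" for u
      using f(2) nn_integral_mono[of M "\<lambda>\<omega>. ennreal (f (X u \<omega>))" "\<lambda>_. 1"] by (simp add: emeasure_space_1)
    then show "AE \<omega> in M. ?G (round_up n \<bar>Y t \<omega>\<bar>) \<le> 1" for n
      by simp
  qed (use measurable_compose[OF T G] measurable_compose[OF T G_meas] G_lim in \<open>auto simp: emeasure_space_1\<close>)
  ultimately show "(\<integral>\<^sup>+ \<omega>. ennreal (f (X \<bar>Y t \<omega>\<bar> \<omega>)) \<partial>completion M) = (\<integral>\<^sup>+ \<omega>. ?G \<bar>Y t \<omega>\<bar> \<partial>M)"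
    by (rule LIMSEQ_unique)
qed

end

section \<open>The density of the iterated Cauchy process\<close>

lemma measurable_q [measurable]: "(\<lambda>x. q x t) \<in> borel_measurable borel"
  unfolding q_def set_lebesgue_integral_def by measurable

lemma distributed_iterated_cauchy:
  assumes M: "prob_space M" and C1: "cauchy_process M C1" and C2: "cauchy_process M C2"
    and indep: "indep_processes M C1 C2" and t: "t > 0"
  shows "distributed (completion M) lborel (iterated_process C1 C2 t) (\<lambda>x. ennreal (q x t))"
proof -
  interpret prob_space M by fact
  interpret cadlag_process M C1
    using C1 by unfold_locales (auto simp: cauchy_process_def levy_process_def)
  interpret cM: prob_space "completion M"
    by (rule prob_spaceI) (simp add: emeasure_space_1)
  have C2t: "C2 t \<in> borel_measurable M"
    using C2 t by (auto simp: cauchy_process_def levy_process_def)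
  have Z: "iterated_process C1 C2 t \<in> borel_measurable (completion M)"
    using measurable_subordinated[OF C2t] by (simp add: iterated_process_def[abs_def])
  interpret Z: prob_space "distr (completion M) borel (iterated_process C1 C2 t)"
    using Z by (rule cM.prob_space_distr)
  have "distr (completion M) borel (iterated_process C1 C2 t) = density lborel (\<lambda>x. ennreal (q x t))"
  proof (rule measure_eqI_continuous_nn_integral)
    fix f :: "real \<Rightarrow> real"
    assume f: "continuous_on UNIV f" "\<And>x. 0 \<le> f x \<and> f x \<le> 1"
    let ?G = "\<lambda>u. \<integral>\<^sup>+ \<omega>. ennreal (f (C1 u \<omega>)) \<partial>M"
    note [measurable] = borel_measurable_continuous_onI[OF f(1)]
    note G = nn_integral_subordinated[OF indep less_imp_le[OF t] f]
    have G_density: "?G u = (\<integral>\<^sup>+ x. ennreal (u / (pi * (u\<^sup>2 + x\<^sup>2))) * ennreal (f x) \<partial>lborel)" if "u > 0" for u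
      using C1 that by (subst distributed_nn_integral) (auto simp: cauchy_process_def)
    have "(\<integral>\<^sup>+ x. ennreal (f x) \<partial>distr (completion M) borel (iterated_process C1 C2 t))
        = (\<integral>\<^sup>+ \<omega>. ?G \<bar>C2 t \<omega>\<bar> \<partial>M)"
      using Z by (subst nn_integral_distr) (auto simp: iterated_process_def G(2))
    also have "\<dots> = (\<integral>\<^sup>+ s. ennreal (t / (pi * (t\<^sup>2 + s\<^sup>2))) * ?G \<bar>s\<bar> \<partial>lborel)"
      by (rule distributed_nn_integral[symmetric]) (use C2 t G(1) in \<open>auto simp: cauchy_process_def\<close>)
    also have "\<dots> = (\<integral>\<^sup>+ s. ennreal (t / (pi * (t\<^sup>2 + s\<^sup>2))) *
        (\<integral>\<^sup>+ x. ennreal (\<bar>s\<bar> / (pi * (s\<^sup>2 + x\<^sup>2))) * ennreal (f x) \<partial>lborel) \<partial>lborel)"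
      \<comment> \<open>\<open>G_density\<close> covers positive times only, the law at time 0 being
        a point mass; \<open>s = 0\<close> is Lebesgue-null.\<close>
      by (rule nn_integral_cong_AE, use AE_lborel_singleton[of 0] in eventually_elim)
        (simp add: G_density)
    also have "\<dots> = (\<integral>\<^sup>+ x. ennreal (q x t) * ennreal (f x) \<partial>lborel)"
      using t by (rule nn_integral_cauchy_mixture) measurable
    also have "\<dots> = (\<integral>\<^sup>+ x. ennreal (f x) \<partial>density lborel (\<lambda>x. ennreal (q x t)))"
      by (rule nn_integral_density[symmetric]) measurable
    finally show "(\<integral>\<^sup>+ x. ennreal (f x) \<partial>distr (completion M) borel (iterated_process C1 C2 t))
        = (\<integral>\<^sup>+ x. ennreal (f x) \<partial>density lborel (\<lambda>x. ennreal (q x t)))" .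
  qed (auto intro: Z.finite_measure_axioms)
  moreover have "distr (completion M) lborel (iterated_process C1 C2 t)
      = distr (completion M) borel (iterated_process C1 C2 t)"
    by (rule distr_cong) auto
  ultimately show ?thesis
    using Z by (auto simp: distributed_def)
qed

theorem theorem4p1:
  fixes M :: "'a measure" and C1 C2 :: "real \<Rightarrow> 'a \<Rightarrow> real"
  assumes "prob_space M"
    and "cauchy_process M C1" and "cauchy_process M C2"
    and "indep_processes M C1 C2"
  shows
    "(\<forall>t>0. distributed (completion M) lborel (iterated_process C1 C2 t) (\<lambda>x. ennreal (q x t))) \<and>
     (\<forall>x t. x \<noteq> 0 \<longrightarrow> t > 0 \<longrightarrow> \<bar>x\<bar> \<noteq> t \<longrightarrow>
        q x t = 2 * t / (pi\<^sup>2 * (t\<^sup>2 - x\<^sup>2)) * ln (t / \<bar>x\<bar>)) \<and>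
     (\<forall>x t. x \<noteq> 0 \<longrightarrow> t > 0 \<longrightarrow> \<bar>x\<bar> = t \<longrightarrow>
        ((\<lambda>(y, s). 2 * s / (pi\<^sup>2 * (s\<^sup>2 - y\<^sup>2)) * ln (s / \<bar>y\<bar>)) \<longlongrightarrow> q x t)
          (at (x, t) within {(y, s). y \<noteq> 0 \<and> s > 0 \<and> \<bar>y\<bar> \<noteq> s})) \<and>
     (\<forall>x t. x \<noteq> 0 \<longrightarrow> t > 0 \<longrightarrow>
        (\<lambda>s. q x s) differentiable (at t) \<and>
        deriv (\<lambda>s. q x s) differentiable (at t) \<and>
        (\<lambda>y. q y t) differentiable (at x) \<and>
        deriv (\<lambda>y. q y t) differentiable (at x) \<and>
        deriv (deriv (\<lambda>s. q x s)) t = deriv (deriv (\<lambda>y. q y t)) x - 2 / (pi\<^sup>2 * t * x\<^sup>2))"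
proof (intro conjI allI impI)
  show "distributed (completion M) lborel (iterated_process C1 C2 t) (\<lambda>x. ennreal (q x t))"
    if "t > 0" for t
    using assms that by (rule distributed_iterated_cauchy)
  show "q x t = 2 * t / (pi\<^sup>2 * (t\<^sup>2 - x\<^sup>2)) * ln (t / \<bar>x\<bar>)"
    if "x \<noteq> 0" "t > 0" "\<bar>x\<bar> \<noteq> t" for x t
    unfolding q_eq_log_quot[OF that(1,2)] using that by (rule log_quot_closed_form)
qed (rule q_limit_diagonal q_wave_equation; assumption)+

end
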